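(* For all integers $x\in\{1,2,3,4\}$ and $k\ge 1$ with $2^k-x\ge 2^{k-1}$, we have $f_d(Q_{2^k-x})=2^k$.
   Context: $Q_n$ is the $n$-dimensional hypercube: vertices are binary strings of length $n$, adjacent iff they differ in exactly one position. The \emph{Explorer–Director game} on a finite connected graph $G$ with starting vertex $v$: a token starts on $v$; in each round, with the token on $u$, the Explorer names a distance $d$ such that some vertex is at distance $d$ from $u$, and the Director moves the token to any vertex at distance exactly $d$ from $u$. Visited vertices are those the token has ever occupied (including $v$). The Explorer maximizes and the Director minimizes the number of visited vertices; the game ends when the Director can keep the token on visited vertices indefinitely; $f_d(G,v)$ is the final number of visited vertices under optimal play. Since $Q_n$ is vertex-transitive, $f_d(Q_n,v)$ does not depend on $v$ and is written $f_d(Q_n)$. *)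

theory Defs
  imports "Graph_Theory.Graph_Theory"
begin

section \<open>The hypercube\<close>

definition hypercube :: "nat \<Rightarrow> bool list pair_pre_digraph" where
  "hypercube n = \<lparr> pverts = {xs. length xs = n},
     parcs = {(xs, ys). length xs = n \<and> length ys = n \<and> (\<exists>!i. i < n \<and> xs ! i \<noteq> ys ! i)} \<rparr>"

section \<open>The Explorer-Director game\<close>

text \<open>Graph distance is the library's shortest-path cost with all edges of weight 1; it is
  infinite, hence never equal to a natural number, for vertices in different components.\<close>

definition at_distance :: "'a pair_pre_digraph \<Rightarrow> nat \<Rightarrow> 'a \<Rightarrow> 'a \<Rightarrow> bool" where
  "at_distance G d u w \<longleftrightarrow> u \<in> pverts G \<and> w \<in> pverts G \<and>
     wf_digraph.\<mu> (with_proj G) (\<lambda>_. 1) u w = ereal (real d)"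

text \<open>A history is the nonempty list of all token positions so far, the current one last. It
  determines the distances named so far, so strategies may depend on the whole past.\<close>

definition explorer_strategy :: "'a pair_pre_digraph \<Rightarrow> ('a list \<Rightarrow> nat) \<Rightarrow> bool" where
  "explorer_strategy G \<sigma> \<longleftrightarrow>
     (\<forall>h. h \<noteq> [] \<longrightarrow> set h \<subseteq> pverts G \<longrightarrow> (\<exists>w. at_distance G (\<sigma> h) (last h) w))"

definition director_strategy :: "'a pair_pre_digraph \<Rightarrow> ('a list \<Rightarrow> nat \<Rightarrow> 'a) \<Rightarrow> bool" where
  "director_strategy G \<tau> \<longleftrightarrow>
     (\<forall>h d. h \<noteq> [] \<longrightarrow> set h \<subseteq> pverts G \<longrightarrow> (\<exists>w. at_distance G d (last h) w) \<longrightarrow>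
        at_distance G d (last h) (\<tau> h d))"

primrec history :: "('a list \<Rightarrow> nat) \<Rightarrow> ('a list \<Rightarrow> nat \<Rightarrow> 'a) \<Rightarrow> 'a \<Rightarrow> nat \<Rightarrow> 'a list" where
  "history \<sigma> \<tau> v 0 = [v]"
| "history \<sigma> \<tau> v (Suc n) =
     history \<sigma> \<tau> v n @ [\<tau> (history \<sigma> \<tau> v n) (\<sigma> (history \<sigma> \<tau> v n))]"

text \<open>The game is over once the Director, playing on from the current token position against any
  Explorer, can keep the token on already visited vertices forever.\<close>

definition game_over :: "'a pair_pre_digraph \<Rightarrow> 'a list \<Rightarrow> bool" where
  "game_over G h \<longleftrightarrow>
     (\<exists>\<tau>. director_strategy G \<tau> \<and>
        (\<forall>\<sigma>. explorer_strategy G \<sigma> \<longrightarrow> (\<forall>n. set (history \<sigma> \<tau> (last h) n) \<subseteq> set h)))"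

text \<open>The vertices visited up to and including the first moment at which the game is over, or
  during the whole infinite play if that never happens.\<close>

definition final_visited ::
    "'a pair_pre_digraph \<Rightarrow> ('a list \<Rightarrow> nat) \<Rightarrow> ('a list \<Rightarrow> nat \<Rightarrow> 'a) \<Rightarrow> 'a \<Rightarrow> 'a set" where
  "final_visited G \<sigma> \<tau> v =
     (\<Union>n \<in> {n. \<forall>m<n. \<not> game_over G (history \<sigma> \<tau> v m)}. set (history \<sigma> \<tau> v n))"

text \<open>The outcome under optimal play is the minimax value: the unique number such that the Explorer
  can guarantee at least, and the Director at most, that many visited vertices.\<close>

definition f_d :: "'a pair_pre_digraph \<Rightarrow> 'a \<Rightarrow> nat" where
  "f_d G v = (THE m.
     (\<exists>\<sigma>. explorer_strategy G \<sigma> \<and>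
        (\<forall>\<tau>. director_strategy G \<tau> \<longrightarrow> m \<le> card (final_visited G \<sigma> \<tau> v))) \<and>
     (\<exists>\<tau>. director_strategy G \<tau> \<and>
        (\<forall>\<sigma>. explorer_strategy G \<sigma> \<longrightarrow> card (final_visited G \<sigma> \<tau> v) \<le> m)))"

section \<open>Sanity checks: the hypercube is a finite connected simple graph with Hamming distance\<close>

lemma pair_graph_hypercube: "pair_graph (hypercube n)"
proof -
  have fin: "finite {xs :: bool list. length xs = n}"
    using finite_lists_length_eq[of "UNIV :: bool set" n] by simp
  have "parcs (hypercube n) \<subseteq> {xs. length xs = n} \<times> {xs. length xs = n}"
    by (auto simp: hypercube_def)
  then have "finite (parcs (hypercube n))"
    using fin by (meson finite_SigmaI finite_subset)
  moreover have "sym (parcs (hypercube n))"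
  proof (rule symI)
    fix xs ys
    assume "(xs, ys) \<in> parcs (hypercube n)"
    then show "(ys, xs) \<in> parcs (hypercube n)"
      unfolding hypercube_def mem_Collect_eq pair_pre_digraph.simps prod.case
      by (metis (no_types, lifting))
  qed
  moreover have "xs \<noteq> ys" if "(xs, ys) \<in> parcs (hypercube n)" for xs ys
    using that by (auto simp: hypercube_def)
  moreover have "pverts (hypercube n) = {xs. length xs = n}"
    by (simp add: hypercube_def)
  moreover have "length xs = n \<and> length ys = n" if "(xs, ys) \<in> parcs (hypercube n)" for xs ys
    using that by (simp add: hypercube_def)
  ultimately show ?thesis
    using fin by unfold_locales (auto simp: symmetric_def)
qed

definition hamming :: "bool list \<Rightarrow> bool list \<Rightarrow> nat" where
  "hamming xs ys = card {i. i < length xs \<and> xs ! i \<noteq> ys ! i}"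

lemma hamming_triangle:
  assumes "(u, w) \<in> parcs (hypercube n)"
  shows "hamming u v \<le> Suc (hamming w v)"
proof -
  from assms have len: "length u = n" "length w = n" and "\<exists>!j. j < n \<and> u ! j \<noteq> w ! j"
    by (simp_all add: hypercube_def)
  then obtain i where i: "\<And>j. j < n \<and> u ! j \<noteq> w ! j \<longleftrightarrow> j = i"
    by metis
  have "{j. j < length u \<and> u ! j \<noteq> v ! j} \<subseteq> insert i {j. j < length w \<and> w ! j \<noteq> v ! j}"
    using i len by auto
  then have "hamming u v \<le> card (insert i {j. j < length w \<and> w ! j \<noteq> v ! j})"
    unfolding hamming_def by (intro card_mono) auto
  also have "\<dots> \<le> Suc (hamming w v)"
    unfolding hamming_def by (rule card_insert_le_m1) auto
  finally show ?thesis .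
qed

lemma hypercube_distance:
  assumes "length u = n" "length v = n"
  shows "wf_digraph.\<mu> (with_proj (hypercube n)) (\<lambda>_. 1) u v = ereal (real (hamming u v))"
proof -
  interpret pair_graph "hypercube n" by (rule pair_graph_hypercube)
  have cost: "awalk_cost (\<lambda>_. 1) p = real (length p)" for p :: "(bool list \<times> bool list) list"
    by (induction p) auto
  have verts: "pverts (hypercube n) = {xs. length xs = n}"
    by (simp add: hypercube_def)
  have lower: "hamming u v \<le> length p" if "awalk u p v" for p
    using that
  proof (induction p arbitrary: u)
    case Nil
    then show ?case by (auto simp: awalk_Nil_iff hamming_def)
  next
    case (Cons e p)
    then have "(u, snd e) \<in> parcs (hypercube n)" "awalk (snd e) p v"
      by (auto simp: awalk_Cons_iff) 
    then show ?case
      using hamming_triangle[of u "snd e" n v] Cons.IH[of "snd e"] by simp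
  qed
  have upper: "\<exists>p. awalk u p v \<and> length p = hamming u v" if "length u = n" for u
    using that
  proof (induction "hamming u v" arbitrary: u)
    case 0
    then have "u = v" using assms by (auto simp: hamming_def intro: nth_equalityI)
    then show ?case using 0 verts by (auto simp: awalk_Nil_iff intro!: exI[of _ "[]"])
  next
    case (Suc k)
    then have "{i. i < length u \<and> u ! i \<noteq> v ! i} \<noteq> {}"
      unfolding hamming_def by (metis card.empty nat.distinct(1))
    then obtain i where i: "i < n" "u ! i \<noteq> v ! i" using Suc by auto
    define w where "w = u[i := v ! i]"
    have "{j. j < length w \<and> w ! j \<noteq> v ! j} = {j. j < length u \<and> u ! j \<noteq> v ! j} - {i}"
      using i Suc.prems by (auto simp: w_def nth_list_update split: if_splits)
    then have k: "k = hamming w v"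
      using Suc.hyps(2) Suc.prems i unfolding hamming_def by (simp add: card_Diff_singleton)
    have lw: "length w = n" using Suc.prems by (simp add: w_def)
    have "\<exists>!j. j < n \<and> u ! j \<noteq> w ! j"
      using i Suc.prems by (intro ex1I[of _ i]) (auto simp: w_def nth_list_update split: if_splits)
    then have arc: "(u, w) \<in> parcs (hypercube n)"
      using Suc.prems lw by (simp add: hypercube_def)
    from Suc.hyps(1)[OF k lw] obtain p where "awalk w p v" "length p = k"
      using k by auto
    then have "awalk u ((u, w) # p) v" "length ((u, w) # p) = hamming u v"
      using arc Suc.hyps(2) by (auto simp: awalk_Cons_iff)
    then show ?case by blast
  qed
  obtain p where p: "awalk u p v" "length p = hamming u v" using upper assms by blast
  show ?thesis
    unfolding \<mu>_def cost
    by (rule antisym) (use p lower in \<open>auto intro!: INF_greatest INF_lower2[of p]\<close>)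
qed

lemma connected_hypercube: "Digraph_Component.connected (with_proj (hypercube n))"
proof -
  interpret pair_graph "hypercube n" by (rule pair_graph_hypercube)
  have "\<mu> (\<lambda>_. 1) u v \<noteq> \<infinity>" if "length u = n" "length v = n" for u v
    using hypercube_distance[OF that] by simp
  then have reach: "u \<rightarrow>\<^sup>*\<^bsub>with_proj (hypercube n)\<^esub> v" if "length u = n" "length v = n" for u v
    using shortest_path_inf that by blast
  have verts: "pverts (hypercube n) = {xs. length xs = n}"
    by (simp add: hypercube_def)
  have "u \<rightarrow>\<^sup>*\<^bsub>mk_symmetric (with_proj (hypercube n))\<^esub> v"
    if "length u = n" "length v = n" for u v
    using reachable_mk_symmetricI[OF reach[OF that]] by simp
  moreover have "replicate n True \<in> {xs :: bool list. length xs = n}"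
    by simp
  ultimately show ?thesis
    by (intro connectedI; unfold verts with_proj_simps) blast+
qed

end

(* Call a vertex set closed if from each of its vertices every distance the Explorer may name can be
   answered inside the set. The Director can stay in any closed set containing the start, and the
   Explorer can force the visited set to contain a nonempty closed set, so the value is the least
   size of such a set.

   In Q_n with 2^(k-1) <= n < 2^k, cutting the positions into blocks whose unions have all sizes
   0, ..., n gives a closed linear code with 2^k words. Conversely, a closed set splits into two
   parity classes, and in each class every word has a partner at each of the n div 2 + 1 even
   distances. If a class has exactly n div 2 + 1 words, these partners are unique, so its words are
   matched at distance 2 and its size is even; for n >= 2^k - 4 this forces at least 2^(k-1) words
   in each class. *)
theory Submission
  imports Defs
begin

section \<open>The game value as the least size of a closed set\<close>

definition closed_set :: "'a pair_pre_digraph \<Rightarrow> 'a set \<Rightarrow> bool" where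
  "closed_set G U \<longleftrightarrow> U \<subseteq> pverts G \<and>
     (\<forall>u \<in> U. \<forall>d. (\<exists>w. at_distance G d u w) \<longrightarrow> (\<exists>w \<in> U. at_distance G d u w))"

text \<open>The empty walk has cost 0, so 0 can be named at every vertex. It is the default move of
  the Explorer strategies below.\<close>

lemma at_distance_0:
  assumes "pair_wf_digraph G" and "u \<in> pverts G"
  shows "at_distance G 0 u u"
proof -
  interpret pair_wf_digraph G by fact
  have cost: "awalk_cost (\<lambda>_. 1) p = real (length p)" for p :: "('a \<times> 'a) list"
    by (induction p) auto
  have "\<mu> (\<lambda>_. 1) u u = 0"
    unfolding \<mu>_def cost
    by (rule antisym) (use assms(2) in \<open>auto simp: awalk_Nil_iff intro!: INF_greatest INF_lower2[of "[]"]\<close>)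
  then show ?thesis
    using assms(2) by (simp add: at_distance_def)
qed

section \<open>Histories of a play\<close>

lemma history_nonempty [simp]: "history \<sigma> \<tau> v n \<noteq> []"
  by (cases n) auto

lemma last_history_in_set: "last (history \<sigma> \<tau> v n) \<in> set (history \<sigma> \<tau> v n)"
  by (rule last_in_set) simp

lemma length_history [simp]: "length (history \<sigma> \<tau> v n) = Suc n"
  by (induction n) auto

lemma set_history_mono: "m \<le> n \<Longrightarrow> set (history \<sigma> \<tau> v m) \<subseteq> set (history \<sigma> \<tau> v n)"
  by (rule lift_Suc_mono_le) auto

lemma history_subset:
  assumes "explorer_strategy G \<sigma>" and "director_strategy G \<tau>" and "v \<in> pverts G"
  shows "set (history \<sigma> \<tau> v n) \<subseteq> pverts G"
proof (induction n)
  case 0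
  then show ?case using assms by simp
next
  case (Suc n)
  let ?h = "history \<sigma> \<tau> v n"
  have "at_distance G (\<sigma> ?h) (last ?h) (\<tau> ?h (\<sigma> ?h))"
    using assms Suc by (simp add: explorer_strategy_def director_strategy_def)
  then show ?case
    using Suc by (simp add: at_distance_def)
qed

lemma history_step:
  fixes n :: nat
  assumes "explorer_strategy G \<sigma>" and "director_strategy G \<tau>" and "v \<in> pverts G"
  defines "h \<equiv> history \<sigma> \<tau> v n"
  shows "at_distance G (\<sigma> h) (last h) (last (history \<sigma> \<tau> v (Suc n)))"
  using assms history_subset[OF assms(1-3), of n]
  by (simp add: explorer_strategy_def director_strategy_def)

lemma final_visited_subset:
  assumes "\<And>n. set (history \<sigma> \<tau> v n) \<subseteq> U"
  shows "final_visited G \<sigma> \<tau> v \<subseteq> U"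
  using assms by (auto simp: final_visited_def)

section \<open>The Director's guarantee\<close>

lemma director_confines:
  assumes "closed_set G U"
  obtains \<tau> where "director_strategy G \<tau>"
    and "\<And>\<sigma> v n. explorer_strategy G \<sigma> \<Longrightarrow> v \<in> U \<Longrightarrow> set (history \<sigma> \<tau> v n) \<subseteq> U"
proof -
  \<comment> \<open>A strategy must also answer at histories that end outside \<open>U\<close>;
    there only legality is asked.\<close>
  define good where
    "good h d w \<longleftrightarrow> at_distance G d (last h) w \<and> (last h \<in> U \<longrightarrow> w \<in> U)" for h d w
  define \<tau> where "\<tau> h d = (SOME w. good h d w)" for h d
  have good: "good h d (\<tau> h d)" if "\<exists>w. at_distance G d (last h) w" for h d
  proof -
    have "\<exists>w. good h d w"
      using that assms unfolding good_def closed_set_def by blast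
    then show ?thesis
      unfolding \<tau>_def by (rule someI_ex)
  qed
  have dir: "director_strategy G \<tau>"
    using good by (auto simp: director_strategy_def good_def)
  have "set (history \<sigma> \<tau> v n) \<subseteq> U" if \<sigma>: "explorer_strategy G \<sigma>" and v: "v \<in> U" for \<sigma> v n
  proof (induction n)
    case 0
    then show ?case using v by simp
  next
    case (Suc n)
    let ?h = "history \<sigma> \<tau> v n"
    have "set ?h \<subseteq> pverts G"
      using Suc assms by (auto simp: closed_set_def)
    then have "\<exists>w. at_distance G (\<sigma> ?h) (last ?h) w"
      using \<sigma> by (simp add: explorer_strategy_def)
    moreover have "last ?h \<in> U"
      using Suc last_in_set[of ?h] by auto
    ultimately have "\<tau> ?h (\<sigma> ?h) \<in> U"
      using good unfolding good_def by blast
    then show ?case using Suc by simp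
  qed
  with dir show ?thesis by (rule that)
qed

section \<open>The Explorer's guarantee\<close>

text \<open>The positions reachable when the Director stays inside the visited set form a closed set:
  the Explorer may deviate at any reachable history.\<close>

lemma game_over_closed_set:
  assumes G: "pair_wf_digraph G" and h: "h \<noteq> []" "set h \<subseteq> pverts G" and "game_over G h"
  obtains W where "closed_set G W" "W \<noteq> {}" "W \<subseteq> set h"
proof -
  obtain \<tau> where \<tau>: "director_strategy G \<tau>"
    and stay: "\<And>\<sigma> n. explorer_strategy G \<sigma> \<Longrightarrow> set (history \<sigma> \<tau> (last h) n) \<subseteq> set h"
    using assms(4) unfolding game_over_def by blast
  define W where "W = {last (history \<sigma> \<tau> (last h) n) |\<sigma> n. explorer_strategy G \<sigma>}"
  have Wh: "W \<subseteq> set h"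
  proof
    fix w
    assume "w \<in> W"
    then obtain \<sigma> n where \<sigma>: "explorer_strategy G \<sigma>" and w: "w = last (history \<sigma> \<tau> (last h) n)"
      by (auto simp: W_def)
    show "w \<in> set h"
      unfolding w by (rule subsetD[OF stay[OF \<sigma>] last_history_in_set])
  qed
  have "explorer_strategy G (\<lambda>_. 0)"
    unfolding explorer_strategy_def using at_distance_0[OF G] last_in_set by blast
  then have "W \<noteq> {}"
    unfolding W_def by blast
  moreover have "\<exists>w' \<in> W. at_distance G d w w'" if w: "w \<in> W" and d: "\<exists>w'. at_distance G d w w'" for w d
  proof -
    obtain \<sigma> n where \<sigma>: "explorer_strategy G \<sigma>" and wn: "w = last (history \<sigma> \<tau> (last h) n)"
      using w by (auto simp: W_def)
    let ?g = "history \<sigma> \<tau> (last h) n"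
    define \<sigma>' where "\<sigma>' = \<sigma>(?g := d)"
    have \<sigma>': "explorer_strategy G \<sigma>'"
      using \<sigma> d wn by (auto simp: explorer_strategy_def \<sigma>'_def)
    \<comment> \<open>Histories before time \<open>n\<close> are shorter than \<open>?g\<close>, so
      changing the strategy at \<open>?g\<close> alone does not affect them.\<close>
    have same: "m \<le> n \<Longrightarrow> history \<sigma>' \<tau> (last h) m = history \<sigma> \<tau> (last h) m" for m
    proof (induction m)
      case (Suc m)
      have "history \<sigma> \<tau> (last h) m \<noteq> ?g"
        using Suc.prems by (metis Suc_n_not_le_n length_history nat.inject)
      then show ?case using Suc by (simp add: \<sigma>'_def)
    qed simp
    have \<sigma>'g: "\<sigma>' ?g = d"
      by (simp add: \<sigma>'_def)
    have "last h \<in> pverts G"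
      using h last_in_set by blast
    from history_step[OF \<sigma>' \<tau> this, of n]
    have "at_distance G d w (last (history \<sigma>' \<tau> (last h) (Suc n)))"
      using same[of n] by (simp add: wn \<sigma>'g)
    moreover have "last (history \<sigma>' \<tau> (last h) (Suc n)) \<in> W"
      unfolding W_def using \<sigma>' by blast
    ultimately show ?thesis by blast
  qed
  ultimately show ?thesis
    using Wh h(2) by (intro that[of W]) (auto simp: closed_set_def)
qed

text \<open>Peeling off vertices that violate closedness one at a time ranks the set so that the
  Explorer can force the rank to drop until the token leaves the set.\<close>

lemma escape_rank:
  assumes "finite S" and "S \<subseteq> pverts G" and "\<And>W. W \<subseteq> S \<Longrightarrow> closed_set G W \<Longrightarrow> W = {}"
  shows "\<exists>\<delta> (r :: 'a \<Rightarrow> nat). \<forall>u \<in> S. (\<exists>w. at_distance G (\<delta> u) u w) \<and>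
           (\<forall>w \<in> S. at_distance G (\<delta> u) u w \<longrightarrow> r w < r u)"
  using assms
proof (induction "card S" arbitrary: S)
  case 0
  then show ?case by simp
next
  case (Suc m)
  then have "\<not> closed_set G S"
    by fastforce
  then obtain a d where a: "a \<in> S" "\<exists>w. at_distance G d a w" "\<forall>w \<in> S. \<not> at_distance G d a w"
    using Suc.prems(2) unfolding closed_set_def by blast
  have "m = card (S - {a})"
    using Suc.hyps(2) a(1) Suc.prems(1) by simp
  then have "\<exists>\<delta> (r :: 'a \<Rightarrow> nat). \<forall>u \<in> S - {a}. (\<exists>w. at_distance G (\<delta> u) u w) \<and>
           (\<forall>w \<in> S - {a}. at_distance G (\<delta> u) u w \<longrightarrow> r w < r u)"
  proof (rule Suc.hyps(1))
    show "finite (S - {a})" "S - {a} \<subseteq> pverts G"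
      using Suc.prems(1,2) by auto
    show "W = {}" if "W \<subseteq> S - {a}" "closed_set G W" for W
      using Suc.prems(3) that by blast
  qed
  then obtain \<delta> and r :: "'a \<Rightarrow> nat" where r: "\<forall>u \<in> S - {a}. (\<exists>w. at_distance G (\<delta> u) u w) \<and>
           (\<forall>w \<in> S - {a}. at_distance G (\<delta> u) u w \<longrightarrow> r w < r u)"
    by blast
  \<comment> \<open>From \<open>a\<close> the distance \<open>d\<close> leaves \<open>S\<close> at
    once, so \<open>a\<close> may take the lowest rank; raising all others makes a move into
    \<open>a\<close> a drop as well.\<close>
  define r' where "r' = (\<lambda>u. Suc (r u))(a := 0)"
  have "\<forall>u \<in> S. (\<exists>w. at_distance G ((\<delta>(a := d)) u) u w) \<and>
           (\<forall>w \<in> S. at_distance G ((\<delta>(a := d)) u) u w \<longrightarrow> r' w < r' u)"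
    using r a by (auto simp: r'_def)
  then show ?case by blast
qed

text \<open>As long as the visited set has no nonempty closed subset, the Explorer names its escape
  distances. The falling rank then drives the token to a new vertex, which can happen only finitely
  often.\<close>

lemma explorer_forces_closed_set:
  assumes G: "pair_wf_digraph G" and fin: "finite (pverts G)"
  obtains \<sigma> where "explorer_strategy G \<sigma>"
    and "\<And>\<tau> v. director_strategy G \<tau> \<Longrightarrow> v \<in> pverts G \<Longrightarrow>
           \<exists>W. closed_set G W \<and> W \<noteq> {} \<and> W \<subseteq> final_visited G \<sigma> \<tau> v"
proof -
  define no_closed where
    "no_closed S \<longleftrightarrow> S \<subseteq> pverts G \<and> (\<forall>W \<subseteq> S. closed_set G W \<longrightarrow> W = {})" for S
  \<comment> \<open>The escape distances are chosen once for each visited set, so that one strategy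
    serves against every Director; the rank only enters the analysis.\<close>
  have "\<forall>S. \<exists>\<delta>. no_closed S \<longrightarrow> (\<exists>r :: 'a \<Rightarrow> nat. \<forall>u \<in> S. (\<exists>w. at_distance G (\<delta> u) u w) \<and>
           (\<forall>w \<in> S. at_distance G (\<delta> u) u w \<longrightarrow> r w < r u))"
  proof
    fix S
    show "\<exists>\<delta>. no_closed S \<longrightarrow> (\<exists>r :: 'a \<Rightarrow> nat. \<forall>u \<in> S. (\<exists>w. at_distance G (\<delta> u) u w) \<and>
           (\<forall>w \<in> S. at_distance G (\<delta> u) u w \<longrightarrow> r w < r u))"
    proof (cases "no_closed S")
      case True
      then have "finite S" "S \<subseteq> pverts G" "\<And>W. W \<subseteq> S \<Longrightarrow> closed_set G W \<Longrightarrow> W = {}"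
        using fin finite_subset unfolding no_closed_def by blast+
      from escape_rank[OF this] show ?thesis by blast
    qed simp
  qed
  from choice[OF this] obtain \<Delta> where \<Delta>: "\<And>S. no_closed S \<Longrightarrow>
      \<exists>r :: 'a \<Rightarrow> nat. \<forall>u \<in> S. (\<exists>w. at_distance G (\<Delta> S u) u w) \<and>
           (\<forall>w \<in> S. at_distance G (\<Delta> S u) u w \<longrightarrow> r w < r u)"
    by blast
  define \<sigma> where "\<sigma> h = (if no_closed (set h) then \<Delta> (set h) (last h) else 0)" for h
  have \<sigma>: "explorer_strategy G \<sigma>"
    unfolding explorer_strategy_def
  proof (intro allI impI)
    fix h :: "'a list"
    assume h: "h \<noteq> []" "set h \<subseteq> pverts G"
    show "\<exists>w. at_distance G (\<sigma> h) (last h) w"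
    proof (cases "no_closed (set h)")
      case True
      then show ?thesis
        using \<Delta>[OF True] last_in_set[OF h(1)] by (auto simp: \<sigma>_def)
    next
      case False
      then show ?thesis
        using at_distance_0[OF G] last_in_set[OF h(1)] h(2) by (auto simp: \<sigma>_def)
    qed
  qed
  have "\<exists>W. closed_set G W \<and> W \<noteq> {} \<and> W \<subseteq> final_visited G \<sigma> \<tau> v"
    if \<tau>: "director_strategy G \<tau>" and v: "v \<in> pverts G" for \<tau> v
  proof (cases "\<exists>n. game_over G (history \<sigma> \<tau> v n)")
    case True
    define n where "n = (LEAST n. game_over G (history \<sigma> \<tau> v n))"
    have over: "game_over G (history \<sigma> \<tau> v n)"
      using True unfolding n_def by (rule LeastI_ex)
    have "\<forall>m<n. \<not> game_over G (history \<sigma> \<tau> v m)"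
      using not_less_Least unfolding n_def by blast
    then have "set (history \<sigma> \<tau> v n) \<subseteq> final_visited G \<sigma> \<tau> v"
      unfolding final_visited_def by blast
    then show ?thesis
      using game_over_closed_set[OF G history_nonempty history_subset[OF \<sigma> \<tau> v] over]
      by (metis subset_trans)
  next
    case False
    define S where "S = final_visited G \<sigma> \<tau> v"
    have S: "S = (\<Union>n. set (history \<sigma> \<tau> v n))"
      using False by (simp add: S_def final_visited_def)
    have Sv: "S \<subseteq> pverts G"
      using history_subset[OF \<sigma> \<tau> v] by (auto simp: S)
    then have "finite S"
      using fin finite_subset by blast
    \<comment> \<open>Every visited vertex appears at some time, and there are finitely many, so one
      time \<open>N\<close> covers them all.\<close>
    obtain N where N: "S \<subseteq> set (history \<sigma> \<tau> v N)"
    proof -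
      have "\<exists>N. T \<subseteq> set (history \<sigma> \<tau> v N)" if "finite T" "T \<subseteq> S" for T
        using that
      proof (induction T rule: finite_induct)
        case (insert a T)
        then obtain N m where "T \<subseteq> set (history \<sigma> \<tau> v N)" "a \<in> set (history \<sigma> \<tau> v m)"
          by (auto simp: S)
        then have "insert a T \<subseteq> set (history \<sigma> \<tau> v (max N m))"
          using set_history_mono[of N "max N m" \<sigma> \<tau> v] set_history_mono[of m "max N m" \<sigma> \<tau> v]
          by auto
        then show ?case by blast
      qed simp
      with \<open>finite S\<close> show ?thesis using that by blast
    qed
    have stable: "set (history \<sigma> \<tau> v n) = S" if "N \<le> n" for n
      using N set_history_mono[OF that, of \<sigma> \<tau> v] by (auto simp: S)
    have "\<not> no_closed S"
    proof
      assume op: "no_closed S"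
      from \<Delta>[OF this] obtain r :: "'a \<Rightarrow> nat"
        where r: "\<forall>u \<in> S. \<forall>w \<in> S. at_distance G (\<Delta> S u) u w \<longrightarrow> r w < r u"
        by blast
      \<comment> \<open>After time \<open>N\<close> the visited set stays \<open>S\<close>, so the
        rule \<open>\<Delta> S\<close> applies in every round and the ranks would descend
        forever.\<close>
      define c where "c i = r (last (history \<sigma> \<tau> v (N + i)))" for i
      have "c (Suc i) < c i" for i
      proof -
        let ?h = "history \<sigma> \<tau> v (N + i)" and ?h' = "history \<sigma> \<tau> v (Suc (N + i))"
        have "at_distance G (\<sigma> ?h) (last ?h) (last ?h')"
          by (rule history_step[OF \<sigma> \<tau> v])
        moreover have "\<sigma> ?h = \<Delta> S (last ?h)"
          using op stable[of "N + i"] by (simp add: \<sigma>_def)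
        moreover have "last ?h \<in> S" "last ?h' \<in> S"
          unfolding S by (rule UN_I[OF UNIV_I], rule last_history_in_set)+
        ultimately show ?thesis
          using r by (simp add: c_def del: history.simps)
      qed
      then show False
        using wf_no_infinite_down_chainE[OF wf_less, of c] by blast
    qed
    then show ?thesis
      using Sv by (auto simp: no_closed_def S_def)
  qed
  with \<sigma> show ?thesis by (rule that)
qed

text \<open>Confinement to \<open>U\<close> bounds the value above, and the forced closed set bounds
  it below by \<open>min\<close>. With \<open>card U \<le> m\<close> instead of equality, the words
  of the code built later need not be shown distinct.\<close>

theorem f_d_eq_closed_set:
  assumes G: "pair_wf_digraph G" and fin: "finite (pverts G)"
    and U: "closed_set G U" "v \<in> U" "card U \<le> m"
    and min: "\<And>W. closed_set G W \<Longrightarrow> W \<noteq> {} \<Longrightarrow> m \<le> card W"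
  shows "f_d G v = m"
proof -
  have v: "v \<in> pverts G"
    using U by (auto simp: closed_set_def)
  have finU: "finite U"
    using U(1) fin by (auto simp: closed_set_def intro: finite_subset)
  obtain \<tau> where \<tau>: "director_strategy G \<tau>"
    and "\<And>\<sigma> v n. explorer_strategy G \<sigma> \<Longrightarrow> v \<in> U \<Longrightarrow> set (history \<sigma> \<tau> v n) \<subseteq> U"
    using director_confines[OF U(1)] by metis
  then have upper: "card (final_visited G \<sigma> \<tau> v) \<le> m" if "explorer_strategy G \<sigma>" for \<sigma>
    using that U(2,3) card_mono[OF finU final_visited_subset] by (meson order_trans)
  obtain \<sigma> where \<sigma>: "explorer_strategy G \<sigma>"
    and "\<And>\<tau> v. director_strategy G \<tau> \<Longrightarrow> v \<in> pverts G \<Longrightarrow>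
           \<exists>W. closed_set G W \<and> W \<noteq> {} \<and> W \<subseteq> final_visited G \<sigma> \<tau> v"
    using explorer_forces_closed_set[OF G fin] by metis
  then have lower: "m \<le> card (final_visited G \<sigma> \<tau>' v)" if \<tau>': "director_strategy G \<tau>'" for \<tau>'
  proof -
    obtain W where W: "closed_set G W" "W \<noteq> {}" "W \<subseteq> final_visited G \<sigma> \<tau>' v"
      using \<sigma> \<tau>' v \<open>\<And>\<tau> v. director_strategy G \<tau> \<Longrightarrow> v \<in> pverts G \<Longrightarrow> _\<close> by blast
    have "finite (final_visited G \<sigma> \<tau>' v)"
      using final_visited_subset[OF history_subset[OF \<sigma> \<tau>' v]] fin finite_subset by blast
    then show ?thesis
      using min[OF W(1,2)] W(3) card_mono order_trans by blast
  qed
  show ?thesis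
    unfolding f_d_def
  proof (rule the_equality)
    show "(\<exists>\<sigma>. explorer_strategy G \<sigma> \<and>
        (\<forall>\<tau>. director_strategy G \<tau> \<longrightarrow> m \<le> card (final_visited G \<sigma> \<tau> v))) \<and>
     (\<exists>\<tau>. director_strategy G \<tau> \<and>
        (\<forall>\<sigma>. explorer_strategy G \<sigma> \<longrightarrow> card (final_visited G \<sigma> \<tau> v) \<le> m))"
      using \<sigma> \<tau> lower upper by blast
  next
    \<comment> \<open>Pitting the Explorer strategy for each of \<open>m\<close>, \<open>m'\<close>
      against the Director strategy for the other gives both inequalities.\<close>
    fix m'
    assume "(\<exists>\<sigma>. explorer_strategy G \<sigma> \<and>
        (\<forall>\<tau>. director_strategy G \<tau> \<longrightarrow> m' \<le> card (final_visited G \<sigma> \<tau> v))) \<and>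
     (\<exists>\<tau>. director_strategy G \<tau> \<and>
        (\<forall>\<sigma>. explorer_strategy G \<sigma> \<longrightarrow> card (final_visited G \<sigma> \<tau> v) \<le> m'))"
    then show "m' = m"
      using \<sigma> \<tau> lower upper by (meson le_antisym order_trans)
  qed
qed

section \<open>Closed sets in the hypercube\<close>

lemma pverts_hypercube [simp]: "pverts (hypercube n) = {xs. length xs = n}"
  by (simp add: hypercube_def)

lemma at_distance_hypercube:
  "at_distance (hypercube n) d u w \<longleftrightarrow> length u = n \<and> length w = n \<and> hamming u w = d"
  using hypercube_distance[of u n w] by (auto simp: at_distance_def)

lemma hamming_le: "hamming u w \<le> length u"
proof -
  have "card {i. i < length u \<and> u ! i \<noteq> w ! i} \<le> card {..<length u}"
    by (rule card_mono) auto
  then show ?thesis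
    by (simp add: hamming_def)
qed

lemma hamming_self [simp]: "hamming u u = 0"
  by (simp add: hamming_def)

lemma hamming_commute: "length u = length w \<Longrightarrow> hamming u w = hamming w u"
  unfolding hamming_def by (rule arg_cong[of _ _ card]) auto

lemma ex_hamming_eq:
  assumes "d \<le> length u"
  shows "\<exists>w. length w = length u \<and> hamming u w = d"
proof -
  \<comment> \<open>On booleans \<open>\<noteq>\<close> is exclusive or, so \<open>?w\<close> flips
    the first \<open>d\<close> bits of \<open>u\<close>.\<close>
  let ?w = "map (\<lambda>i. u ! i \<noteq> (i < d)) [0..<length u]"
  have "{i. i < length u \<and> u ! i \<noteq> ?w ! i} = {..<d}"
    using assms by auto
  then show ?thesis
    by (intro exI[of _ ?w]) (simp add: hamming_def)
qed

lemma closed_set_hypercube: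
  "closed_set (hypercube n) U \<longleftrightarrow> U \<subseteq> {xs. length xs = n} \<and>
     (\<forall>u \<in> U. \<forall>d \<le> n. \<exists>w \<in> U. hamming u w = d)"
proof -
  have 1: "(\<exists>w. at_distance (hypercube n) d u w) \<longleftrightarrow> d \<le> n"
    if "U \<subseteq> {xs. length xs = n}" "u \<in> U" for u d
    using that ex_hamming_eq[of d u] hamming_le[of u] by (auto simp: at_distance_hypercube)
  have 2: "(\<exists>w \<in> U. at_distance (hypercube n) d u w) \<longleftrightarrow> (\<exists>w \<in> U. hamming u w = d)"
    if "U \<subseteq> {xs. length xs = n}" "u \<in> U" for u d
    using that by (auto simp: at_distance_hypercube)
  show ?thesis
    unfolding closed_set_def pverts_hypercube
    by (intro conj_cong ball_cong refl) (simp only: 1 2)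
qed

text \<open>Among three bits the number of unequal pairs is 0 or 2. Hence the parity of the distance
  to a fixed word splits a set into two classes with even distances inside each.\<close>

lemma even_hamming_triangle:
  assumes "length u = n" "length v = n" "length w = n"
  shows "even (hamming u v + hamming v w + hamming u w)"
proof -
  have *: "hamming a b = (\<Sum>i<n. of_bool (a ! i \<noteq> b ! i))" if "length a = n" for a b
    using that by (simp add: hamming_def sum.If_cases of_bool_def lessThan_def Collect_conj_eq)
  have "hamming u v + hamming v w + hamming u w =
      (\<Sum>i<n. of_bool (u ! i \<noteq> v ! i) + of_bool (v ! i \<noteq> w ! i) + of_bool (u ! i \<noteq> w ! i))"
    using assms by (simp only: * sum.distrib)
  then show ?thesis
    by (simp only:) (rule dvd_sum, auto)
qed

section \<open>Lower bound from parity classes\<close>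

text \<open>The orbits \<open>{a, f a}\<close> are two-element sets that partition
  \<open>A\<close>.\<close>

lemma even_card_involution:
  assumes "finite A" and "\<And>a. a \<in> A \<Longrightarrow> f a \<in> A \<and> f a \<noteq> a \<and> f (f a) = a"
  shows "even (card A)"
proof -
  have union: "\<Union> ((\<lambda>a. {a, f a}) ` A) = A"
    using assms by auto
  have "2 dvd card (\<Union> ((\<lambda>a. {a, f a}) ` A))"
  proof (rule dvd_partition)
    show "finite (\<Union> ((\<lambda>a. {a, f a}) ` A))"
      using assms(1) by simp
    have "card {a, f a} = 2" if "a \<in> A" for a
      using assms(2)[OF that] by (auto simp: card_insert_if)
    then show "\<forall>c \<in> (\<lambda>a. {a, f a}) ` A. 2 dvd card c"
      by simp
    have "{a, f a} = {b, f b}" if "a \<in> A" "b \<in> A" "{a, f a} \<inter> {b, f b} \<noteq> {}" for a b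
    proof -
      have inv: "f (f a) = a" "f (f b) = b"
        using assms(2) that(1,2) by auto
      have "a = b \<or> a = f b \<or> f a = b \<or> f a = f b"
        using that(3) by auto
      then have "a = b \<or> a = f b"
        using inv by metis
      then show ?thesis
        using inv by auto
    qed
    then show "\<forall>c\<^sub>1 \<in> (\<lambda>a. {a, f a}) ` A. \<forall>c\<^sub>2 \<in> (\<lambda>a. {a, f a}) ` A. c\<^sub>1 \<noteq> c\<^sub>2 \<longrightarrow> c\<^sub>1 \<inter> c\<^sub>2 = {}"
      by blast
  qed
  with union show ?thesis by simp
qed

lemma card_even_upto: "card {d. d \<le> n \<and> even d} = Suc (n div 2)"
proof -
  have "{d. d \<le> n \<and> even d} = (\<lambda>i. 2 * i) ` {..n div 2}"
    by (auto elim!: evenE)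
  then show ?thesis
    by (simp add: card_image inj_on_def)
qed

text \<open>If the bound is attained, the distance-2 pairs form a perfect matching of \<open>P\<close>.\<close>

lemma parity_class_card:
  assumes fin: "finite P" and ne: "P \<noteq> {}" and len: "P \<subseteq> {xs. length xs = n}"
    and dist: "\<And>u d. u \<in> P \<Longrightarrow> d \<le> n \<Longrightarrow> even d \<Longrightarrow> \<exists>w \<in> P. hamming u w = d"
  shows "Suc (n div 2) \<le> card P"
    and "2 \<le> n \<Longrightarrow> card P = Suc (n div 2) \<Longrightarrow> even (card P)"
proof -
  have sub: "{d. d \<le> n \<and> even d} \<subseteq> hamming u ` P" if "u \<in> P" for u
    using dist[OF that] by force
  have le: "Suc (n div 2) \<le> card (hamming u ` P)" if "u \<in> P" for u
    using card_mono[OF finite_imageI[OF fin] sub[OF that]] by (simp add: card_even_upto)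
  then show "Suc (n div 2) \<le> card P"
    using ne card_image_le[OF fin] by (meson all_not_in_conv order_trans)
  show "even (card P)" if n: "2 \<le> n" and eq: "card P = Suc (n div 2)"
  proof -
    \<comment> \<open>The distances from \<open>u\<close> take at least as many values as
      \<open>P\<close> has words, so no value repeats.\<close>
    have inj: "inj_on (hamming u) P" if "u \<in> P" for u
      using le[OF that] card_image_le[OF fin, of "hamming u"] eq
      by (intro eq_card_imp_inj_on[OF fin]) simp
    have "\<forall>u \<in> P. \<exists>w \<in> P. hamming u w = 2"
      using dist n by simp
    then obtain f where f: "\<And>u. u \<in> P \<Longrightarrow> f u \<in> P \<and> hamming u (f u) = 2"
      by metis
    show ?thesis
    proof (rule even_card_involution[OF fin])
      fix u
      assume u: "u \<in> P"
      then have "hamming (f u) u = 2"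
        using f[OF u] len hamming_commute[of u "f u"] by auto
      \<comment> \<open>Both \<open>f (f u)\<close> and \<open>u\<close> lie in \<open>P\<close> at
        distance 2 from \<open>f u\<close>.\<close>
      then have "f (f u) = u"
        using f u inj[of "f u"] by (metis inj_onD)
      moreover have "f u \<noteq> u"
        using f[OF u] by fastforce
      ultimately show "f u \<in> P \<and> f u \<noteq> u \<and> f (f u) = u"
        using f[OF u] by blast
    qed
  qed
qed

text \<open>Each parity class has at least \<open>q\<close> words. In the second case of
  \<open>q\<close>, \<open>Suc (n div 2)\<close> is odd, so the matching excludes that size and
  gains one more word.\<close>

lemma closed_set_card_ge:
  assumes closed: "closed_set (hypercube n) U" and "U \<noteq> {}" and "1 \<le> n"
    and q: "q \<le> Suc (n div 2) \<or> (2 \<le> n \<and> even (n div 2) \<and> q \<le> n div 2 + 2)"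
  shows "2 * q \<le> card U"
proof -
  have len: "U \<subseteq> {xs. length xs = n}" and ex: "\<And>u d. u \<in> U \<Longrightarrow> d \<le> n \<Longrightarrow> \<exists>w \<in> U. hamming u w = d"
    using closed by (auto simp: closed_set_hypercube)
  have fin: "finite U"
    using len finite_lists_length_eq[of "UNIV :: bool set" n] by (auto intro: finite_subset)
  obtain u where u: "u \<in> U"
    using assms(2) by blast
  have half: "q \<le> card {w \<in> U. even (hamming u w) = b}" for b
  proof -
    let ?P = "{w \<in> U. even (hamming u w) = b}"
    have ne: "?P \<noteq> {}"
    proof (cases b)
      case True
      then show ?thesis
        using u by (auto intro: exI[of _ u])
    next
      \<comment> \<open>A word at distance 1 from \<open>u\<close> represents the odd class; this is
        where \<open>1 \<le> n\<close> enters.\<close>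
      case False
      then show ?thesis
        using ex[OF u, of 1] assms(3) by force
    qed
    \<comment> \<open>An answer at even distance keeps the parity of the distance to
      \<open>u\<close>, so it stays in the class.\<close>
    have dist: "\<exists>w' \<in> ?P. hamming w w' = d" if w: "w \<in> ?P" and d: "d \<le> n" "even d" for w d
    proof -
      obtain w' where w': "w' \<in> U" "hamming w w' = d"
        using ex[of w d] w d by auto
      have "even (hamming u w + hamming w w' + hamming u w')"
        by (rule even_hamming_triangle) (use len u w w' in auto)
      then show ?thesis
        using w w' d by auto
    qed
    have P: "finite ?P" "?P \<subseteq> {xs. length xs = n}"
      using fin len by auto
    have "Suc (n div 2) \<le> card ?P"
      by (rule parity_class_card(1)[OF P(1) ne P(2) dist])
    moreover have "even (card ?P)" if "2 \<le> n" "card ?P = Suc (n div 2)"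
      by (rule parity_class_card(2)[OF P(1) ne P(2) dist that])
    ultimately show ?thesis
      using q by (smt (verit) Suc_leI add_2_eq_Suc' even_Suc le_antisym not_less order_trans)
  qed
  have "card U = card ({w \<in> U. even (hamming u w) = True} \<union> {w \<in> U. even (hamming u w) = False})"
    by (rule arg_cong[of _ _ card]) auto
  also have "\<dots> = card {w \<in> U. even (hamming u w) = True} + card {w \<in> U. even (hamming u w) = False}"
    using fin by (intro card_Un_disjoint) auto
  finally show ?thesis
    using half[of True] half[of False] by simp
qed

section \<open>Upper bound from a block code\<close>

text \<open>The new block holds the upper half of the positions, so adding it or not covers all sizes.\<close>

lemma ex_block_partition:
  "n < 2 ^ k \<Longrightarrow> \<exists>b :: nat \<Rightarrow> nat. (\<forall>i < n. b i < k) \<and>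
     (\<forall>d \<le> n. \<exists>C \<subseteq> {..<k}. card {i. i < n \<and> b i \<in> C} = d)"
proof (induction k arbitrary: n)
  case 0
  then show ?case by auto
next
  case (Suc k)
  define m where "m = n div 2"
  have "m < 2 ^ k"
    using Suc.prems by (simp add: m_def less_mult_imp_div_less mult.commute)
  then obtain b :: "nat \<Rightarrow> nat" where bk: "\<forall>i < m. b i < k"
    and b: "\<forall>d \<le> m. \<exists>C \<subseteq> {..<k}. card {i. i < m \<and> b i \<in> C} = d"
    using Suc.IH by blast
  define b' where "b' i = (if i < m then b i else k)" for i
  \<comment> \<open>The new block exceeds the old ones together by at most one position. So
    \<open>d > m\<close> gives \<open>d \<ge> n - m\<close>, and the subtraction
    \<open>d - (n - m)\<close> below is not truncated.\<close>
  have mn: "m \<le> n" "n - m \<le> Suc m"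
    by (auto simp: m_def)
  have "\<exists>C \<subseteq> {..<Suc k}. card {i. i < n \<and> b' i \<in> C} = d" if d: "d \<le> n" for d
  proof (cases "d \<le> m")
    case True
    then obtain C where C: "C \<subseteq> {..<k}" "card {i. i < m \<and> b i \<in> C} = d"
      using b by blast
    have "{i. i < n \<and> b' i \<in> C} = {i. i < m \<and> b i \<in> C}"
      using C(1) mn by (auto simp: b'_def split: if_splits)
    then show ?thesis
      using C by (intro exI[of _ C]) auto
  next
    case False
    obtain C where C: "C \<subseteq> {..<k}" "card {i. i < m \<and> b i \<in> C} = d - (n - m)"
      proof -
      have "d - (n - m) \<le> m"
        using d by simp
      then show ?thesis
        using b that by blast
    qed
    have "{i. i < n \<and> b' i \<in> insert k C} = {i. i < m \<and> b i \<in> C} \<union> {m..<n}"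
    proof (rule set_eqI)
      show "i \<in> {i. i < n \<and> b' i \<in> insert k C} \<longleftrightarrow> i \<in> {i. i < m \<and> b i \<in> C} \<union> {m..<n}" for i
        using C(1) mn bk by (cases "i < m") (auto simp: b'_def)
    qed
    moreover have "card ({i. i < m \<and> b i \<in> C} \<union> {m..<n}) = d - (n - m) + (n - m)"
      using C(2) by (subst card_Un_disjoint) auto
    ultimately have "card {i. i < n \<and> b' i \<in> insert k C} = d"
      using False mn by simp
    then show ?thesis
      using C(1) by (intro exI[of _ "insert k C"]) auto
  qed
  moreover have "\<forall>i < n. b' i < Suc k"
    using bk by (auto simp: b'_def intro: less_SucI)
  ultimately show ?case by blast
qed

text \<open>A translate by \<open>v\<close> of the linear code spanned by the indicator words of the blocks; its
  distances are its weights, that is, the sizes of unions of blocks.\<close>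

lemma ex_closed_set_hypercube:
  assumes "n < 2 ^ k" and v: "length v = n"
  shows "\<exists>U. closed_set (hypercube n) U \<and> v \<in> U \<and> card U \<le> 2 ^ k"
proof -
  obtain b :: "nat \<Rightarrow> nat" where b: "\<forall>d \<le> n. \<exists>C \<subseteq> {..<k}. card {i. i < n \<and> b i \<in> C} = d"
    using ex_block_partition[OF assms(1)] by blast
  \<comment> \<open>\<open>c A\<close> is \<open>v\<close> with the blocks indexed by
    \<open>A\<close> flipped.\<close>
  define c where "c A = map (\<lambda>i. v ! i \<noteq> (b i \<in> A)) [0..<n]" for A
  have len: "length (c A) = n" for A
    by (simp add: c_def)
  define U where "U = c ` Pow {..<k}"
  \<comment> \<open>The translation by \<open>v\<close> cancels, leaving the blocks in the symmetric
    difference of \<open>A\<close> and \<open>B\<close>.\<close>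
  have ham: "hamming (c A) (c B) = card {i. i < n \<and> b i \<in> (A - B) \<union> (B - A)}" for A B
    unfolding hamming_def by (rule arg_cong[of _ _ card]) (auto simp: c_def)
  have "\<exists>w \<in> U. hamming u w = d" if u: "u \<in> U" and d: "d \<le> n" for u d
  proof -
    obtain A where A: "A \<subseteq> {..<k}" "u = c A"
      using u by (auto simp: U_def)
    obtain C where C: "C \<subseteq> {..<k}" "card {i. i < n \<and> b i \<in> C} = d"
      using b d by blast
    define B where "B = (A - C) \<union> (C - A)"
    have "(A - B) \<union> (B - A) = C"
      by (auto simp: B_def)
    then have "hamming u (c B) = d"
      using C(2) A(2) by (simp only: ham)
    moreover have "c B \<in> U"
      using A(1) C(1) by (auto simp: U_def B_def)
    ultimately show ?thesis by blast
  qed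
  then have "closed_set (hypercube n) U"
    using len by (auto simp: closed_set_hypercube U_def)
  moreover have "c {} = v"
    using v by (auto simp: c_def intro: nth_equalityI)
  then have "v \<in> U"
    unfolding U_def by force
  moreover have "card U \<le> 2 ^ k"
    unfolding U_def using card_image_le[of "Pow {..<k}" c] by (simp add: card_Pow)
  ultimately show ?thesis by blast
qed

section \<open>The dimensions \<open>2 ^ k - x\<close>\<close>

theorem theorem4p7:
  fixes x k :: nat and v :: "bool list"
  assumes "x \<in> {1, 2, 3, 4}" and "k \<ge> 1"
    and "2 ^ k - x \<ge> 2 ^ (k - 1)"
    and "v \<in> pverts (hypercube (2 ^ k - x))"
  shows "f_d (hypercube (2 ^ k - x)) v = 2 ^ k"
proof -
  define n where "n = 2 ^ k - x"
  define q :: nat where "q = 2 ^ (k - 1)"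
  have k: "(2 :: nat) ^ k = 2 * q"
    using assms(2) unfolding q_def by (metis Suc_diff_1 Suc_le_eq One_nat_def power_Suc)
  have nx: "n = 2 * q - x"
    by (simp add: n_def k)
  have qn: "q \<le> n" "1 \<le> q"
    using assms(3) by (auto simp: n_def q_def)
  \<comment> \<open>For \<open>x\<close> = 1, 2 we have \<open>n div 2 = q - 1\<close> and the plain
    bound is enough. For \<open>x\<close> = 3, 4 we have \<open>n div 2 = q - 2\<close>; there
    \<open>q \<le> n\<close> rules out \<open>q = 1\<close>, so \<open>n div 2\<close> is even and
    the extra word is available.\<close>
  have "q = 1 \<or> even q"
    by (cases "k - 1") (auto simp: q_def)
  then have q: "q \<le> Suc (n div 2) \<or> (2 \<le> n \<and> even (n div 2) \<and> q \<le> n div 2 + 2)"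
    using assms(1) qn nx by auto presburger+
  obtain U where U: "closed_set (hypercube n) U" "v \<in> U" "card U \<le> 2 ^ k"
    using ex_closed_set_hypercube[of n k v] assms(1,4) k qn by (auto simp: nx)
  interpret pair_graph "hypercube n"
    by (rule pair_graph_hypercube)
  have "f_d (hypercube n) v = 2 ^ k"
  proof (rule f_d_eq_closed_set[OF _ _ U])
    show "pair_wf_digraph (hypercube n)"
      by unfold_locales
    show "finite (pverts (hypercube n))"
      using finite_lists_length_eq[of "UNIV :: bool set" n] by simp
    show "2 ^ k \<le> card W" if "closed_set (hypercube n) W" "W \<noteq> {}" for W
      using closed_set_card_ge[OF that _ q] qn by (simp add: k)
  qed
  then show ?thesis
    by (simp add: n_def)
qed

end
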